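(* Let $\alpha\in(0,1)$, $f_\alpha(x)=\frac{1-\alpha}2|x|^{-\alpha}\mathbb 1_{|x|\in[0,1]}$ on $\mathbb R$ (with $1/0=+\infty$), and for $z\in\mathbb R$ let $F_{\alpha,z}$ be the probability distribution on $\mathbb R$ with Lebesgue density $x\mapsto f_\alpha(x-z)$. For $w,q_{12},q_{21}\in[0,1]$ and $z\in\mathbb R$ let $$P_{w,q,z}=wF_{\alpha,0}\otimes[(1-q_{12})F_{\alpha,0}+q_{12}F_{\alpha,z}]+(1-w)F_{\alpha,z}\otimes[q_{21}F_{\alpha,0}+(1-q_{21})F_{\alpha,z}].$$ Let $z^*\ne0$, $w^*\in[0,1)$, $q^*_{12}\in[0,1]$ and $q_{21}^*\in[0,1)$. Then there is a constant $C(\alpha,z^*,w^*,q^* )$ such that for all $w,q_{12},q_{21}\in[0,1]$ and all $z\in\mathbb R$, $$C(\alpha,z^*,w^*,q^* )\,h^2(P_{w,q,z},P_{w^*,q^*,z^*})\ge(|z-z^*|\wedge1)^{1-\alpha}+(w^* )^2(q_{12}-q_{12}^* )^2+(1-w^* )^2(q_{21}-q_{21}^* )^2+(w-w^* )^2.$$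
   Context: $h$ is the Hellinger distance, $h^2(P,Q)=\frac12\int(\sqrt{dP/d\mu}-\sqrt{dQ/d\mu})^2d\mu$ for any dominating measure $\mu$; $q=(q_{12},q_{21})$, $q^*=(q_{12}^*,q_{21}^* )$. *)

theory Defs
  imports "HOL-Probability.Probability"
begin

text \<open>The mixture \<open>w M + (1 - w) N\<close> of two measures on the same measurable space, for \<open>0 \<le> w \<le> 1\<close>.\<close>

definition mixture :: "real \<Rightarrow> 'a measure \<Rightarrow> 'a measure \<Rightarrow> 'a measure" where
  "mixture w M N = measure_of (space M) (sets M)
     (\<lambda>A. ennreal w * emeasure M A + ennreal (1 - w) * emeasure N A)"

lemma space_mixture [simp]: "space (mixture w M N) = space M"
  by (simp add: mixture_def)

lemma sets_mixture [simp, measurable_cong]: "sets (mixture w M N) = sets M"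
  by (simp add: mixture_def)

lemma emeasure_mixture:
  assumes "sets N = sets M" "A \<in> sets M"
  shows "emeasure (mixture w M N) A = ennreal w * emeasure M A + ennreal (1 - w) * emeasure N A"
  unfolding mixture_def
proof (rule emeasure_measure_of_sigma)
  show "countably_additive (sets M)
          (\<lambda>A. ennreal w * emeasure M A + ennreal (1 - w) * emeasure N A)"
  proof (rule countably_additiveI)
    fix B :: "nat \<Rightarrow> 'a set"
    assume B: "range B \<subseteq> sets M" "disjoint_family B"
    have "(\<Sum>i. ennreal w * emeasure M (B i) + ennreal (1 - w) * emeasure N (B i)) =
          (\<Sum>i. ennreal w * emeasure M (B i)) + (\<Sum>i. ennreal (1 - w) * emeasure N (B i))"
      by (intro suminf_add[symmetric]) auto
    also have "\<dots> = ennreal w * (\<Sum>i. emeasure M (B i)) + ennreal (1 - w) * (\<Sum>i. emeasure N (B i))"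
      by simp
    also have "\<dots> = ennreal w * emeasure M (\<Union>i. B i) + ennreal (1 - w) * emeasure N (\<Union>i. B i)"
      using B assms(1) by (simp add: suminf_emeasure)
    finally show "(\<Sum>i. ennreal w * emeasure M (B i) + ennreal (1 - w) * emeasure N (B i)) =
        ennreal w * emeasure M (\<Union>i. B i) + ennreal (1 - w) * emeasure N (\<Union>i. B i)" .
  qed
qed (auto simp: positive_def assms sets.sigma_algebra_axioms)

lemma prob_space_mixture:
  assumes "prob_space M" "prob_space N" "sets N = sets M" "0 \<le> w" "w \<le> 1"
  shows "prob_space (mixture w M N)"
proof
  have "emeasure (mixture w M N) (space M) = ennreal w + ennreal (1 - w)"
    using prob_space.emeasure_space_1[OF assms(1)] prob_space.emeasure_space_1[OF assms(2)]
      sets_eq_imp_space_eq[OF assms(3)] by (simp add: emeasure_mixture assms(3))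
  also have "\<dots> = 1"
    using assms(4,5) by (simp flip: ennreal_plus)
  finally show "emeasure (mixture w M N) (space (mixture w M N)) = 1" by simp
qed

text \<open>
  The Hellinger distance, computed with the dominating measure \<open>(P + Q) / 2\<close>; lemma
  \<open>hellinger_sq_density\<close> shows that any other sigma-finite dominating measure gives the same value.
\<close>

definition hellinger :: "'a measure \<Rightarrow> 'a measure \<Rightarrow> real" where
  "hellinger P Q =
     (let \<mu> = mixture (1/2) P Q in
      sqrt (1/2 * (LINT x|\<mu>. (sqrt (enn2real (RN_deriv \<mu> P x)) - sqrt (enn2real (RN_deriv \<mu> Q x)))\<^sup>2)))"

lemma hellinger_sq_density:
  assumes \<mu>: "sigma_finite_measure \<mu>"
    and p [measurable]: "p \<in> borel_measurable \<mu>" and P: "P = density \<mu> p" "finite_measure P"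
    and q [measurable]: "q \<in> borel_measurable \<mu>" and Q: "Q = density \<mu> q" "finite_measure Q"
  shows "(hellinger P Q)\<^sup>2 = 1/2 * (LINT x|\<mu>. (sqrt (enn2real (p x)) - sqrt (enn2real (q x)))\<^sup>2)"
proof -
  interpret \<mu>: sigma_finite_measure \<mu> by fact
  define \<nu> where "\<nu> = mixture (1/2) P Q"
  define g where "g x = ennreal (1/2) * p x + ennreal (1/2) * q x" for x
  have g [measurable]: "g \<in> borel_measurable \<mu>" unfolding g_def by measurable
  have sets_PQ: "sets P = sets \<mu>" "sets Q = sets \<mu>" by (simp_all add: P Q)
  have \<nu>: "\<nu> = density \<mu> g"
  proof (rule measure_eqI)
    fix A assume "A \<in> sets \<nu>"
    then have A [measurable]: "A \<in> sets \<mu>" by (simp add: \<nu>_def sets_PQ)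
    have "emeasure (density \<mu> g) A =
       (\<integral>\<^sup>+x. ennreal (1/2) * (p x * indicator A x) + ennreal (1/2) * (q x * indicator A x) \<partial>\<mu>)"
      by (subst emeasure_density) (auto simp: g_def distrib_right mult.assoc intro!: nn_integral_cong)
    also have "\<dots> = ennreal (1/2) * emeasure P A + ennreal (1/2) * emeasure Q A"
      by (simp add: nn_integral_add nn_integral_cmult P Q emeasure_density)
    finally show "emeasure \<nu> A = emeasure (density \<mu> g) A"
      using A by (simp add: \<nu>_def emeasure_mixture sets_PQ)
  qed (simp add: \<nu>_def sets_PQ)
  have "integral\<^sup>N \<mu> p \<noteq> \<infinity>" "integral\<^sup>N \<mu> q \<noteq> \<infinity>"
    using finite_measure.emeasure_finite[OF P(2), of "space \<mu>"]
      finite_measure.emeasure_finite[OF Q(2), of "space \<mu>"]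
    by (auto simp: P Q emeasure_density cong: nn_integral_cong)
  then have "AE x in \<mu>. p x \<noteq> \<infinity>" "AE x in \<mu>. q x \<noteq> \<infinity>"
    using nn_integral_PInf_AE[OF p] nn_integral_PInf_AE[OF q] by blast+
  then have g_fin: "AE x in \<mu>. g x = ennreal (enn2real (g x))"
  proof eventually_elim
    case (elim x)
    have "ennreal (1/2) * y < top" if "y < top" for y
      using that ennreal_less_top[of "1/2"] unfolding ennreal_mult_less_top by blast
    with elim have "g x < top"
      unfolding g_def ennreal_add_eq_top less_top[symmetric] infinity_ennreal_def by blast
    then show ?case by simp
  qed
  then have \<nu>': "\<nu> = density \<mu> (\<lambda>x. ennreal (enn2real (g x)))"
    unfolding \<nu> by (intro density_cong) auto
  have fin: "finite_measure \<nu>"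
    using finite_measure.emeasure_finite[OF P(2), of "space \<mu>"]
      finite_measure.emeasure_finite[OF Q(2), of "space \<mu>"]
    by (intro finite_measureI) (simp add: \<nu>_def emeasure_mixture sets_PQ
        sets_eq_imp_space_eq[OF sets_PQ(1)] ennreal_mult_eq_top_iff)
  then interpret \<nu>: sigma_finite_measure \<nu> by (simp add: finite_measure_def)
  have RN: "AE x in \<mu>. g x * RN_deriv \<nu> R x = r x"
    if r [measurable]: "r \<in> borel_measurable \<mu>" and R: "R = density \<mu> r"
      and r_le: "\<And>x. g x = 0 \<Longrightarrow> r x = 0" for R r
  proof -
    have "absolutely_continuous \<nu> R"
      unfolding absolutely_continuous_def null_sets_def
    proof safe
      fix A assume "A \<in> sets \<nu>" and 0: "emeasure \<nu> A = 0"
      then have A [measurable]: "A \<in> sets \<mu>" by (simp add: \<nu>)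
      then show "A \<in> sets R" by (simp add: R)
      have "AE x in \<mu>. g x * indicator A x = 0"
        using 0 by (simp add: \<nu> emeasure_density nn_integral_0_iff_AE)
      then have "AE x in \<mu>. r x * indicator A x = 0"
        by eventually_elim (auto simp: r_le)
      then show "emeasure R A = 0"
        by (simp add: R emeasure_density nn_integral_0_iff_AE)
    qed
    then have "density \<nu> (RN_deriv \<nu> R) = R"
      by (rule \<nu>.density_RN_deriv) (simp add: R \<nu>)
    moreover have [measurable]: "RN_deriv \<nu> R \<in> borel_measurable \<mu>"
      using borel_measurable_RN_deriv[of \<nu> R] by (simp add: \<nu>)
    ultimately have "density \<mu> (\<lambda>x. g x * RN_deriv \<nu> R x) = density \<mu> r"
      unfolding R by (simp add: \<nu> density_density_eq)
    then show ?thesis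
      by (subst (asm) \<mu>.density_unique_iff) auto
  qed
  have [measurable]: "RN_deriv \<nu> R \<in> borel_measurable \<mu>" for R
    using borel_measurable_RN_deriv[of \<nu> R] by (simp add: \<nu>)
  have "(LINT x|\<nu>. (sqrt (enn2real (RN_deriv \<nu> P x)) - sqrt (enn2real (RN_deriv \<nu> Q x)))\<^sup>2) =
    (LINT x|\<mu>. enn2real (g x) *\<^sub>R
       (sqrt (enn2real (RN_deriv \<nu> P x)) - sqrt (enn2real (RN_deriv \<nu> Q x)))\<^sup>2)"
    by (subst (1) \<nu>', rule integral_density) auto
  also have "\<dots> = (LINT x|\<mu>. (sqrt (enn2real (p x)) - sqrt (enn2real (q x)))\<^sup>2)"
  proof (rule integral_cong_AE)
    have "AE x in \<mu>. g x * RN_deriv \<nu> P x = p x"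
      by (rule RN) (use P in \<open>auto simp: g_def\<close>)
    moreover have "AE x in \<mu>. g x * RN_deriv \<nu> Q x = q x"
      by (rule RN) (use Q in \<open>auto simp: g_def\<close>)
    ultimately show "AE x in \<mu>. enn2real (g x) *\<^sub>R
        (sqrt (enn2real (RN_deriv \<nu> P x)) - sqrt (enn2real (RN_deriv \<nu> Q x)))\<^sup>2 =
        (sqrt (enn2real (p x)) - sqrt (enn2real (q x)))\<^sup>2"
    proof eventually_elim
      case (elim x)
      have "enn2real (g x) * (a - b)\<^sup>2 = (sqrt (enn2real (g x)) * a - sqrt (enn2real (g x)) * b)\<^sup>2"
        for a b by (simp add: power_mult_distrib flip: right_diff_distrib)
      then show ?case
        unfolding elim[symmetric] enn2real_mult real_sqrt_mult by simp
    qed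
  qed auto
  finally show ?thesis
    by (simp add: hellinger_def Let_def flip: \<nu>_def)
qed

text \<open>
  Division in \<open>ennreal\<close> gives \<open>f_dens \<alpha> 0 = \<infinity>\<close>, i.e. the convention \<open>1/0 = \<infinity>\<close>.
\<close>

definition f_dens :: "real \<Rightarrow> real \<Rightarrow> ennreal" where
  "f_dens \<alpha> x = ennreal ((1 - \<alpha>) / 2) / ennreal (\<bar>x\<bar> powr \<alpha>) * indicator {0..1} \<bar>x\<bar>"

definition F_dist :: "real \<Rightarrow> real \<Rightarrow> real measure" where
  "F_dist \<alpha> z = density lborel (\<lambda>x. f_dens \<alpha> (x - z))"

definition P_mix :: "real \<Rightarrow> real \<Rightarrow> real \<times> real \<Rightarrow> real \<Rightarrow> (real \<times> real) measure" where
  "P_mix \<alpha> w = (\<lambda>(q12, q21) z.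
     mixture w (F_dist \<alpha> 0 \<Otimes>\<^sub>M mixture (1 - q12) (F_dist \<alpha> 0) (F_dist \<alpha> z))
               (F_dist \<alpha> z \<Otimes>\<^sub>M mixture q21 (F_dist \<alpha> 0) (F_dist \<alpha> z)))"

lemma f_dens_0: "\<alpha> < 1 \<Longrightarrow> f_dens \<alpha> 0 = \<infinity>"
  by (simp add: f_dens_def ennreal_eq_0_iff)

lemma f_dens_nonzero: "\<alpha> < 1 \<Longrightarrow> x \<noteq> 0 \<Longrightarrow>
    f_dens \<alpha> x = ennreal ((1 - \<alpha>) / 2 * \<bar>x\<bar> powr (- \<alpha>) * indicator {0..1} \<bar>x\<bar>)"
  by (cases "\<bar>x\<bar> \<le> 1") (simp_all add: f_dens_def divide_ennreal powr_minus_divide)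

lemma borel_measurable_f_dens [measurable]: "f_dens \<alpha> \<in> borel_measurable borel"
  unfolding f_dens_def by measurable

lemma sets_F_dist [simp, measurable_cong]: "sets (F_dist \<alpha> z) = sets borel"
  by (simp add: F_dist_def)

lemma prob_space_F_dist:
  assumes "0 < \<alpha>" "\<alpha> < 1"
  shows "prob_space (F_dist \<alpha> z)"
proof
  let ?G = "\<lambda>x::real. x powr (1 - \<alpha>) / 2"
  let ?g = "\<lambda>x::real. (1 - \<alpha>) / 2 * x powr (- \<alpha>)"
  have half: "(\<integral>\<^sup>+x. f_dens \<alpha> x * indicator {0<..} x \<partial>lborel) = ennreal (1/2)"
  proof -
    have int: "set_integrable lborel (einterval 0 1) ?g"
      and val: "(LBINT x=0..1. ?g x) = 1/2 - 0"
    proof -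
      have d: "DERIV ?G x :> ?g x" if "0 < ereal x" for x
        using that by (auto intro!: derivative_eq_intros has_real_derivative_powr)
      have c: "isCont ?g x" if "0 < ereal x" for x
        using that by (auto intro!: continuous_intros)
      have l0: "((?G \<circ> real_of_ereal) \<longlongrightarrow> 0) (at_right 0)"
        unfolding zero_ereal_def ereal_tendsto_simps
      proof -
        have "eventually (\<lambda>x::real. 0 \<le> x) (at_right 0)"
          by (auto simp: eventually_at_filter)
        then have "((\<lambda>x::real. x powr (1 - \<alpha>)) \<longlongrightarrow> 0 powr (1 - \<alpha>)) (at_right 0)"
          using assms by (intro tendsto_powr' tendsto_ident_at tendsto_const) auto
        from tendsto_divide[OF this tendsto_const[of 2]]
        show "((\<lambda>x. x powr (1 - \<alpha>) / 2) \<longlongrightarrow> 0) (at_right 0)" by simp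
      qed
      have l1: "((?G \<circ> real_of_ereal) \<longlongrightarrow> 1/2) (at_left 1)"
        unfolding one_ereal_def ereal_tendsto_simps
        by (auto intro!: tendsto_eq_intros)
      show "set_integrable lborel (einterval 0 1) ?g"
        by (rule interval_integral_FTC_nonneg(1)[OF _ d c _ l0 l1]) (use assms in auto)
      show "(LBINT x=0..1. ?g x) = 1/2 - 0"
        by (rule interval_integral_FTC_nonneg(2)[OF _ d c _ l0 l1]) (use assms in auto)
    qed
    have e: "einterval 0 1 = {0<..<1}"
      by (simp add: zero_ereal_def one_ereal_def)
    have "(\<integral>\<^sup>+x. f_dens \<alpha> x * indicator {0<..} x \<partial>lborel) =
        (\<integral>\<^sup>+x. ennreal (indicator {0<..<1} x *\<^sub>R ?g x) \<partial>lborel)"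
      using AE_lborel_singleton[of "1::real"]
      by (intro nn_integral_cong_AE, eventually_elim)
         (use assms in \<open>auto simp: f_dens_nonzero indicator_def\<close>)
    also have "\<dots> = ennreal (LINT x|lborel. indicator {0<..<1} x *\<^sub>R ?g x)"
      using int assms unfolding set_integrable_def e
      by (intro nn_integral_eq_integral) (auto simp: indicator_def)
    also have "(LINT x|lborel. indicator {0<..<1} x *\<^sub>R ?g x) = 1/2"
      using val by (simp add: interval_lebesgue_integral_def set_lebesgue_integral_def e
          mult.left_commute[of "indicat_real _ _"])
    finally show ?thesis .
  qed
  have sym: "(\<integral>\<^sup>+x. f_dens \<alpha> x * indicator {..<0} x \<partial>lborel) = (\<integral>\<^sup>+x. f_dens \<alpha> x * indicator {0<..} x \<partial>lborel)"
    by (subst nn_integral_real_affine[where c="-1" and t=0])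
       (auto simp: f_dens_def indicator_def intro!: nn_integral_cong)
  have "emeasure (F_dist \<alpha> z) (space (F_dist \<alpha> z)) = (\<integral>\<^sup>+x. f_dens \<alpha> (x - z) \<partial>lborel)"
    by (simp add: F_dist_def emeasure_density)
  also have "\<dots> = (\<integral>\<^sup>+x. f_dens \<alpha> x \<partial>lborel)"
    by (subst nn_integral_real_affine[where c=1 and t=z]) auto
  also have "\<dots> = (\<integral>\<^sup>+x. f_dens \<alpha> x * indicator {..<0} x + f_dens \<alpha> x * indicator {0<..} x \<partial>lborel)"
    using AE_lborel_singleton[of "0::real"]
    by (intro nn_integral_cong_AE, eventually_elim) (auto simp: indicator_def)
  also have "\<dots> = ennreal (1/2) + ennreal (1/2)"
    by (subst nn_integral_add) (simp_all only: sym half, measurable)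
  also have "\<dots> = 1"
    by (subst ennreal_plus[symmetric]) simp_all
  finally show "emeasure (F_dist \<alpha> z) (space (F_dist \<alpha> z)) = 1" .
qed

lemma sets_P_mix [simp]: "sets (P_mix \<alpha> w q z) = sets borel"
proof -
  have "sets (F_dist \<alpha> 0 \<Otimes>\<^sub>M mixture v (F_dist \<alpha> 0) (F_dist \<alpha> z)) =
      sets ((borel :: real measure) \<Otimes>\<^sub>M (borel :: real measure))" for v
    by (rule sets_pair_measure_cong) simp_all
  then show ?thesis
    by (cases q) (simp only: P_mix_def prod.case sets_mixture borel_prod)
qed

lemma prob_space_P_mix:
  assumes "0 < \<alpha>" "\<alpha> < 1" "0 \<le> w" "w \<le> 1"
    and "0 \<le> q12" "q12 \<le> 1" "0 \<le> q21" "q21 \<le> 1"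
  shows "prob_space (P_mix \<alpha> w (q12, q21) z)"
proof -
  have pair: "prob_space (M \<Otimes>\<^sub>M N)" if "prob_space M" "prob_space N"
    for M N :: "real measure"
  proof -
    interpret M: prob_space M by fact
    interpret N: prob_space N by fact
    interpret pair_prob_space M N ..
    show ?thesis by unfold_locales
  qed
  have F: "prob_space (F_dist \<alpha> x)" for x
    using assms by (intro prob_space_F_dist)
  have mix: "prob_space (mixture v (F_dist \<alpha> 0) (F_dist \<alpha> z))" if "0 \<le> v" "v \<le> 1" for v
    using that by (intro prob_space_mixture F) simp_all
  show ?thesis
    unfolding P_mix_def prod.case
  proof (rule prob_space_mixture)
    show "sets (F_dist \<alpha> z \<Otimes>\<^sub>M mixture q21 (F_dist \<alpha> 0) (F_dist \<alpha> z)) =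
          sets (F_dist \<alpha> 0 \<Otimes>\<^sub>M mixture (1 - q12) (F_dist \<alpha> 0) (F_dist \<alpha> z))"
      by (rule sets_pair_measure_cong) simp_all
    show "prob_space (F_dist \<alpha> 0 \<Otimes>\<^sub>M mixture (1 - q12) (F_dist \<alpha> 0) (F_dist \<alpha> z))"
      using assms by (intro pair F mix) simp_all
    show "prob_space (F_dist \<alpha> z \<Otimes>\<^sub>M mixture q21 (F_dist \<alpha> 0) (F_dist \<alpha> z))"
      using assms by (intro pair F mix) simp_all
  qed fact+
qed

end

theory Submission
  imports Defs
begin

text \<open>
  Two measures at Hellinger distance \<open>h\<close> give every event nearly the same probability: by
  Cauchy-Schwarz, \<open>(\<surd>P(A) - \<surd>Q(A))\<^sup>2 \<le> 2 h\<^sup>2\<close> (\<open>sqrt_measure_diff_le_hellinger\<close>), hence also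
  \<open>\<bar>P(A) - Q(A)\<bar> \<le> \<surd>8 h\<close>. So it suffices to exhibit, for each parameter, rectangles whose
  probabilities reveal it. All rectangles have sides \<open>\<real>\<close> or one short interval \<open>I\<close>, and the only facts
  about \<open>F\<^sub>z\<close> that enter are that an interval of small radius \<open>r\<close> has mass of order
  \<open>r\<^bsup>1-\<alpha>\<^esup>\<close> if it lies at distance at most of order \<open>r\<close> from the singularity \<open>z\<close>, and mass smaller by
  the factor \<open>K\<^bsup>-\<alpha>\<^esup>\<close> if it lies at distance at least \<open>K r\<close>.

  Location (\<open>hellinger_detects_location\<close>). Since \<open>w\<^sup>* < 1\<close>, the first marginal of the target is
  singular at \<open>z\<^sup>*\<close>. If \<open>r\<close> is a small multiple of \<open>\<bar>z - z\<^sup>*\<bar> \<and> 1\<close>, both singularities \<open>0\<close> and \<open>z\<close> of the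
  competing first marginal are many radii away from \<open>I = [z\<^sup>* - r, z\<^sup>* + r]\<close>. Hence \<open>I \<times> \<real>\<close> has mass at
  least \<open>u\<close> under the target and at most \<open>u/4\<close> under the competitor, with \<open>u\<close> of order
  \<open>r\<^bsup>1-\<alpha>\<^esup>\<close>. The square roots differ by \<open>\<surd>u/2\<close>, so \<open>h\<^sup>2\<close> is at least of order
  \<open>(\<bar>z - z\<^sup>*\<bar> \<and> 1)\<^bsup>1-\<alpha>\<^esup>\<close>, whatever the weights are.

  Weights (\<open>hellinger_detects_weights\<close>). If \<open>z\<close> is bounded away from \<open>z\<^sup>*\<close>, the first part bounds
  \<open>h\<close> below by a constant, and the weight terms are bounded. If \<open>z\<close> is near \<open>z\<^sup>*\<close>, let \<open>I\<close> be an
  interval of fixed radius centred at the midpoint of \<open>z\<close> and \<open>z\<^sup>*\<close>. By symmetry \<open>F\<^sub>z\<close> and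
  \<open>F\<^bsub>z*\<^esub>\<close> give \<open>I\<close> exactly the same mass \<open>b\<close>, so no continuity estimate in \<open>z\<close> is necessary, while
  \<open>F\<^sub>0\<close> gives it a mass \<open>a\<close> with \<open>b - a\<close> bounded below. The probabilities of \<open>I \<times> \<real>\<close>, \<open>\<real> \<times> I\<close> and
  \<open>I \<times> I\<close> are then affine in \<open>(w, w q\<^sub>1\<^sub>2, (1-w) q\<^sub>2\<^sub>1)\<close> with the same coefficients under both measures,
  and this linear system is invertible with a bound that depends on \<open>b - a\<close> only
  (\<open>mixture_parameters_from_rectangles\<close>).
\<close>

section \<open>Hellinger distance and probabilities of events\<close>

text \<open>
  With densities \<open>p\<close> and \<open>q\<close>, the maps \<open>\<surd>p\<close> and \<open>\<surd>q\<close> restricted to \<open>A\<close> have \<open>L\<^sup>2\<close> norms \<open>\<surd>P(A)\<close> and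
  \<open>\<surd>Q(A)\<close>, so this is the reverse triangle inequality in \<open>L\<^sup>2\<close>. It is derived from the pointwise
  estimate \<open>2 \<surd>(p q) \<le> t p + q / t\<close>, integrated over \<open>A\<close> and optimised over the constant \<open>t > 0\<close>.
\<close>

lemma sqrt_measure_diff_le_hellinger:
  assumes "finite_measure P" "finite_measure Q" "sets Q = sets P" "A \<in> sets P"
  shows "(sqrt (measure P A) - sqrt (measure Q A))\<^sup>2 \<le> 2 * (hellinger P Q)\<^sup>2"
proof -
  interpret P: finite_measure P by fact
  interpret Q: finite_measure Q by fact
  define \<mu> where "\<mu> = mixture (1/2) P Q"
  have sets_\<mu> [measurable_cong]: "sets \<mu> = sets P"
    by (simp add: \<mu>_def)
  have em: "emeasure \<mu> B = ennreal (1/2) * emeasure P B + ennreal (1/2) * emeasure Q B"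
    if "B \<in> sets P" for B
    using that assms unfolding \<mu>_def by (subst emeasure_mixture) auto
  have "emeasure \<mu> (space \<mu>) \<noteq> \<infinity>"
    using em[of "space P"] P.emeasure_finite[of "space P"] Q.emeasure_finite[of "space P"]
    by (simp add: sets_eq_imp_space_eq[OF sets_\<mu>] ennreal_mult_eq_top_iff)
  then interpret \<mu>: finite_measure \<mu>
    by (intro finite_measureI)
  \<comment> \<open>For \<open>R\<close> absolutely continuous with respect to \<open>\<mu>\<close>, the truncation of the Radon-Nikodym
    derivative to the reals loses nothing, since \<open>R\<close> is finite.\<close>
  have density: "integrable \<mu> (\<lambda>x. enn2real (RN_deriv \<mu> R x)) \<and>
      (\<forall>B\<in>sets P. (LINT x|\<mu>. indicator B x * enn2real (RN_deriv \<mu> R x)) = measure R B)"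
    if R: "finite_measure R" "sets R = sets P"
      and null: "\<And>B. B \<in> sets P \<Longrightarrow> emeasure \<mu> B = 0 \<Longrightarrow> emeasure R B = 0" for R
  proof -
    interpret R: finite_measure R by fact
    have "absolutely_continuous \<mu> R"
      unfolding absolutely_continuous_def null_sets_def using null R by (auto simp: sets_\<mu>)
    then have R_eq: "density \<mu> (RN_deriv \<mu> R) = R"
      by (rule \<mu>.density_RN_deriv) (simp add: R sets_\<mu>)
    have "integral\<^sup>N \<mu> (RN_deriv \<mu> R) = emeasure (density \<mu> (RN_deriv \<mu> R)) (space \<mu>)"
      by (subst emeasure_density) (auto cong: nn_integral_cong)
    also have "\<dots> < \<infinity>"
      unfolding R_eq using R.emeasure_finite[of "space \<mu>"] by (simp add: less_top[symmetric])
    finally have "AE x in \<mu>. RN_deriv \<mu> R x \<noteq> \<infinity>"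
      by (intro nn_integral_PInf_AE) auto
    then have "AE x in \<mu>. RN_deriv \<mu> R x = ennreal (enn2real (RN_deriv \<mu> R x))"
      by eventually_elim (simp add: less_top)
    then have "density \<mu> (RN_deriv \<mu> R) = density \<mu> (\<lambda>x. ennreal (enn2real (RN_deriv \<mu> R x)))"
      by (intro density_cong) auto
    then have R_real: "R = density \<mu> (\<lambda>x. ennreal (enn2real (RN_deriv \<mu> R x)))"
      using R_eq by simp
    have "integrable R (\<lambda>_. 1::real)"
      by simp
    then have "integrable \<mu> (\<lambda>x. enn2real (RN_deriv \<mu> R x))"
      by (subst (asm) R_real, subst (asm) integrable_density) auto
    moreover have "(LINT x|\<mu>. indicator B x * enn2real (RN_deriv \<mu> R x)) = measure R B"
      if B: "B \<in> sets P" for B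
    proof -
      have [measurable]: "B \<in> sets \<mu>" using B by (simp add: sets_\<mu>)
      have "measure R B = (LINT x|R. indicator B x)"
        using B R by simp
      also have "\<dots> = (LINT x|\<mu>. enn2real (RN_deriv \<mu> R x) *\<^sub>R indicator B x)"
        by (subst (1) R_real, rule integral_density) auto
      finally show ?thesis by (simp add: mult.commute)
    qed
    ultimately show ?thesis by blast
  qed
  define p where "p x = enn2real (RN_deriv \<mu> P x)" for x
  define q where "q x = enn2real (RN_deriv \<mu> Q x)" for x
  have nonneg: "p x \<ge> 0" "q x \<ge> 0" for x
    by (simp_all add: p_def q_def)
  have p: "integrable \<mu> p" "(LINT x|\<mu>. indicator A x * p x) = measure P A"
    using density[of P] assms em by (auto simp: p_def[abs_def])
  have q: "integrable \<mu> q" "(LINT x|\<mu>. indicator A x * q x) = measure Q A"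
    using density[of Q] assms em by (auto simp: q_def[abs_def])
  have A [measurable]: "A \<in> sets \<mu>" using assms by (simp add: sets_\<mu>)
  note [measurable] = borel_measurable_integrable[OF p(1)] borel_measurable_integrable[OF q(1)]
  define H where "H = (LINT x|\<mu>. (sqrt (p x) - sqrt (q x))\<^sup>2)"
  have H: "2 * (hellinger P Q)\<^sup>2 = H"
    by (simp add: hellinger_def Let_def H_def p_def q_def flip: \<mu>_def)
  have weighted: "(1 - t) * measure P A + (1 - 1/t) * measure Q A \<le> H" if t: "t > 0" for t
  proof -
    have "(1 - t) * measure P A + (1 - 1/t) * measure Q A =
        (LINT x|\<mu>. (1 - t) * (indicator A x * p x) + (1 - 1/t) * (indicator A x * q x))"
      using p q integrable_mult_indicator[OF A p(1)] integrable_mult_indicator[OF A q(1)]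
      by (subst Bochner_Integration.integral_add) auto
    also have "\<dots> \<le> H"
      unfolding H_def
    proof (rule integral_mono)
      show "integrable \<mu> (\<lambda>x. (1 - t) * (indicator A x * p x) + (1 - 1/t) * (indicator A x * q x))"
        using integrable_mult_indicator[OF A p(1)] integrable_mult_indicator[OF A q(1)] by auto
      show "integrable \<mu> (\<lambda>x. (sqrt (p x) - sqrt (q x))\<^sup>2)"
      proof (rule Bochner_Integration.integrable_bound)
        show "integrable \<mu> (\<lambda>x. p x + q x)" using p q by auto
        show "AE x in \<mu>. norm ((sqrt (p x) - sqrt (q x))\<^sup>2) \<le> norm (p x + q x)"
        proof (rule AE_I2)
          fix x
          have "(sqrt (p x) - sqrt (q x))\<^sup>2 \<le> p x + q x"
            using nonneg[of x] by (simp add: power2_diff)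
          then show "norm ((sqrt (p x) - sqrt (q x))\<^sup>2) \<le> norm (p x + q x)"
            using nonneg[of x] by simp
        qed
      qed auto
      fix x
      have "0 \<le> (sqrt t * sqrt (p x) - sqrt (q x) / sqrt t)\<^sup>2" by simp
      also have "\<dots> = t * p x + q x / t - 2 * sqrt (p x) * sqrt (q x)"
        using t nonneg by (simp add: power2_diff power_mult_distrib power_divide)
      finally have "(1 - t) * p x + (1 - 1/t) * q x \<le> (sqrt (p x) - sqrt (q x))\<^sup>2"
        using nonneg by (simp add: power2_diff algebra_simps)
      then show "(1 - t) * (indicator A x * p x) + (1 - 1/t) * (indicator A x * q x)
          \<le> (sqrt (p x) - sqrt (q x))\<^sup>2"
        by (auto simp: indicator_def)
    qed
    finally show ?thesis .
  qed
  show ?thesis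
  proof (cases "measure P A = 0 \<or> measure Q A = 0")
    case True
    have "measure P A + measure Q A \<le> H"
    \<comment> \<open>The optimal \<open>t\<close> would be \<open>\<infinity>\<close> or \<open>0\<close> here and is only approached in the limit \<open>s \<rightarrow> 1\<close>.\<close>
    proof (rule field_le_mult_one_interval)
      fix s :: real assume s: "0 < s" "s < 1"
      show "s * (measure P A + measure Q A) \<le> H"
        using True
      proof
        assume "measure P A = 0"
        then show ?thesis using weighted[of "1 / (1 - s)"] s by simp
      next
        assume "measure Q A = 0"
        then show ?thesis using weighted[of "1 - s"] s by simp
      qed
    qed
    then show ?thesis using True by (auto simp: H)
  next
    case False
    then have pos: "measure P A > 0" "measure Q A > 0"
      by (auto simp: zero_less_measure_iff)
    define a b where "a = sqrt (measure P A)" and "b = sqrt (measure Q A)"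
    have ab: "a > 0" "b > 0" "measure P A = a\<^sup>2" "measure Q A = b\<^sup>2"
      using pos by (simp_all add: a_def b_def)
    have "(a - b)\<^sup>2 = (1 - b / a) * a\<^sup>2 + (1 - 1 / (b / a)) * b\<^sup>2"
      using ab by (simp add: field_simps power2_eq_square)
    also have "\<dots> \<le> H"
      using weighted[of "b / a"] ab by simp
    finally show ?thesis
      by (simp add: H a_def b_def)
  qed
qed

lemma measure_diff_le_hellinger:
  assumes P: "prob_space P" and Q: "prob_space Q" and "sets Q = sets P" "A \<in> sets P"
  shows "\<bar>measure P A - measure Q A\<bar> \<le> sqrt 8 * \<bar>hellinger P Q\<bar>"
proof -
  have "\<bar>sqrt (measure P A) - sqrt (measure Q A)\<bar> \<le> sqrt (2 * (hellinger P Q)\<^sup>2)"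
    using sqrt_measure_diff_le_hellinger[of P Q A] assms(3,4)
      prob_space.finite_measure[OF P] prob_space.finite_measure[OF Q]
    by (intro real_le_rsqrt) simp
  moreover have "sqrt (measure P A) + sqrt (measure Q A) \<le> 2"
    using prob_space.prob_le_1[OF P, of A] prob_space.prob_le_1[OF Q, of A]
      real_sqrt_le_1_iff[of "measure P A"] real_sqrt_le_1_iff[of "measure Q A"] by linarith
  ultimately have "\<bar>sqrt (measure P A) - sqrt (measure Q A)\<bar> * (sqrt (measure P A) + sqrt (measure Q A))
      \<le> sqrt (2 * (hellinger P Q)\<^sup>2) * 2"
    by (intro mult_mono) auto
  moreover have "measure P A - measure Q A =
      (sqrt (measure P A) - sqrt (measure Q A)) * (sqrt (measure P A) + sqrt (measure Q A))"
    by (simp add: algebra_simps)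
  then have "\<bar>measure P A - measure Q A\<bar> =
      \<bar>sqrt (measure P A) - sqrt (measure Q A)\<bar> * (sqrt (measure P A) + sqrt (measure Q A))"
    by (simp add: abs_mult)
  moreover have "sqrt (2 * (hellinger P Q)\<^sup>2) * 2 = sqrt 8 * \<bar>hellinger P Q\<bar>"
  proof -
    have "sqrt (2\<^sup>2 * 2) = 2 * sqrt 2"
      by (subst real_sqrt_mult) simp
    then show ?thesis by (simp add: real_sqrt_mult)
  qed
  ultimately show ?thesis by simp
qed

section \<open>Masses of intervals near and far from the singularity\<close>

text \<open>
  The density \<open>f\<close> is decreasing in \<open>\<bar>x\<bar>\<close>. Comparing it on the interval with its value at distance \<open>R\<close>
  from the singularity gives the same bound from above if the interval lies outside that distance,
  and from below if it lies inside. Choosing \<open>R\<close> proportional to \<open>r\<close> gives the order \<open>r\<^bsup>1-\<alpha>\<^esup>\<close> in both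
  cases, and the two radii \<open>R\<close> control the ratio.
\<close>

lemma F_dist_cball_upper:
  assumes "0 < \<alpha>" "\<alpha> < 1" "0 < R" "0 \<le> r" "r + R \<le> \<bar>c - z\<bar>"
  shows "measure (F_dist \<alpha> z) (cball c r) \<le> (1 - \<alpha>) * R powr (- \<alpha>) * r"
proof -
  have "emeasure (F_dist \<alpha> z) (cball c r) = (\<integral>\<^sup>+x. f_dens \<alpha> (x - z) * indicator (cball c r) x \<partial>lborel)"
    unfolding F_dist_def by (subst emeasure_density) auto
  also have "\<dots> \<le> (\<integral>\<^sup>+x. ennreal ((1 - \<alpha>) / 2 * R powr (- \<alpha>)) * indicator {c - r..c + r} x \<partial>lborel)"
  proof (rule nn_integral_mono)
    fix x
    show "f_dens \<alpha> (x - z) * indicator (cball c r) x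
        \<le> ennreal ((1 - \<alpha>) / 2 * R powr (- \<alpha>)) * indicator {c - r..c + r} x"
    proof (cases "x \<in> cball c r")
      case True
      then have x: "R \<le> \<bar>x - z\<bar>" "x \<in> {c - r..c + r}"
        using assms(5) by (auto simp: dist_real_def)
      then have "\<bar>x - z\<bar> powr (- \<alpha>) \<le> R powr (- \<alpha>)"
        using assms by (intro powr_mono2') auto
      then have "ennreal ((1 - \<alpha>) / 2 * \<bar>x - z\<bar> powr (- \<alpha>) * indicator {0..1} \<bar>x - z\<bar>)
          \<le> ennreal ((1 - \<alpha>) / 2 * R powr (- \<alpha>))"
        using assms by (intro ennreal_leI) (auto simp: indicator_def mult_left_mono)
      then show ?thesis
        using x True assms by (subst f_dens_nonzero) (auto simp del: mem_cball)
    qed auto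
  qed
  also have "\<dots> = ennreal ((1 - \<alpha>) * R powr (- \<alpha>) * r)"
    using assms by (simp add: nn_integral_cmult_indicator flip: ennreal_mult)
  finally show ?thesis
    using assms by (simp add: measure_def enn2real_leI)
qed

lemma F_dist_cball_lower:
  assumes "0 < \<alpha>" "\<alpha> < 1" "0 < r" "\<bar>c - z\<bar> + r \<le> R" "R \<le> 1"
  shows "(1 - \<alpha>) * R powr (- \<alpha>) * r \<le> measure (F_dist \<alpha> z) (cball c r)"
proof -
  interpret prob_space "F_dist \<alpha> z" using assms by (intro prob_space_F_dist)
  have "ennreal ((1 - \<alpha>) * R powr (- \<alpha>) * r) =
      (\<integral>\<^sup>+x. ennreal ((1 - \<alpha>) / 2 * R powr (- \<alpha>)) * indicator {c - r..c + r} x \<partial>lborel)"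
    using assms by (simp add: nn_integral_cmult_indicator flip: ennreal_mult)
  also have "\<dots> \<le> (\<integral>\<^sup>+x. f_dens \<alpha> (x - z) * indicator (cball c r) x \<partial>lborel)"
  proof (rule nn_integral_mono)
    fix x
    show "ennreal ((1 - \<alpha>) / 2 * R powr (- \<alpha>)) * indicator {c - r..c + r} x
        \<le> f_dens \<alpha> (x - z) * indicator (cball c r) x"
    proof (cases "x \<in> {c - r..c + r}")
      case True
      then have x: "\<bar>x - z\<bar> \<le> R" "x \<in> cball c r"
        using assms by (auto simp: dist_real_def)
      show ?thesis
      proof (cases "x = z")
        case True
        then show ?thesis using x assms by (simp add: f_dens_0)
      next
        case False
        then have "R powr (- \<alpha>) \<le> \<bar>x - z\<bar> powr (- \<alpha>)"
          using assms x by (intro powr_mono2') auto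
        then have "ennreal ((1 - \<alpha>) / 2 * R powr (- \<alpha>))
            \<le> ennreal ((1 - \<alpha>) / 2 * \<bar>x - z\<bar> powr (- \<alpha>) * indicator {0..1} \<bar>x - z\<bar>)"
          using assms x by (intro ennreal_leI) (auto simp: mult_left_mono)
        then show ?thesis
          using x assms False True by (subst f_dens_nonzero) auto
      qed
    qed auto
  qed
  also have "\<dots> = emeasure (F_dist \<alpha> z) (cball c r)"
    unfolding F_dist_def by (subst emeasure_density) auto
  finally show ?thesis
    by (simp add: emeasure_eq_measure)
qed

text \<open>The reflection \<open>x \<mapsto> z + z' - x\<close> fixes the interval and exchanges the two distributions.\<close>

lemma F_dist_cball_midpoint:
  "measure (F_dist \<alpha> z) (cball ((z + z') / 2) r) = measure (F_dist \<alpha> z') (cball ((z + z') / 2) r)"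
proof -
  let ?I = "cball ((z + z') / 2) r"
  have [measurable]: "?I \<in> sets borel" by simp
  have *: "emeasure (F_dist \<alpha> y) ?I = (\<integral>\<^sup>+x. f_dens \<alpha> (x - y) * indicator ?I x \<partial>lborel)" for y
    unfolding F_dist_def by (subst emeasure_density) auto
  have "(\<integral>\<^sup>+x. f_dens \<alpha> (x - z) * indicator ?I x \<partial>lborel) =
      (\<integral>\<^sup>+x. f_dens \<alpha> ((z + z') + (- 1) * x - z) * indicator ?I ((z + z') + (- 1) * x) \<partial>lborel)"
    by (subst nn_integral_real_affine[where c = "- 1" and t = "z + z'"], measurable)
  also have "\<dots> = (\<integral>\<^sup>+x. f_dens \<alpha> (x - z') * indicator ?I x \<partial>lborel)"
    by (intro nn_integral_cong arg_cong2[where f = "(*)"])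
       (auto simp: f_dens_def indicator_def dist_real_def abs_minus_commute abs_if field_simps)
  finally show ?thesis
    by (simp add: measure_def *)
qed

section \<open>Probabilities of rectangles\<close>

lemma measure_mixture:
  assumes "finite_measure M" "finite_measure N" "sets N = sets M" "A \<in> sets M"
    and "0 \<le> w" "w \<le> 1"
  shows "measure (mixture w M N) A = w * measure M A + (1 - w) * measure N A"
proof -
  interpret M: finite_measure M by fact
  interpret N: finite_measure N by fact
  have "emeasure (mixture w M N) A = ennreal (w * measure M A + (1 - w) * measure N A)"
    using assms by (simp add: emeasure_mixture M.emeasure_eq_measure N.emeasure_eq_measure
        ennreal_mult ennreal_plus)
  then show ?thesis
    using assms(5,6) by (simp add: measure_def[of "mixture w M N"] del: ennreal_plus)
qed

lemma measure_P_mix_Times: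
  assumes "0 < \<alpha>" "\<alpha> < 1" "w \<in> {0..1}" "q12 \<in> {0..1}" "q21 \<in> {0..1}"
    and A: "A \<in> sets borel" and B: "B \<in> sets borel"
  shows "measure (P_mix \<alpha> w (q12, q21) z) (A \<times> B) =
      w * measure (F_dist \<alpha> 0) A *
        ((1 - q12) * measure (F_dist \<alpha> 0) B + q12 * measure (F_dist \<alpha> z) B) +
      (1 - w) * measure (F_dist \<alpha> z) A *
        (q21 * measure (F_dist \<alpha> 0) B + (1 - q21) * measure (F_dist \<alpha> z) B)"
proof -
  have F: "prob_space (F_dist \<alpha> y)" for y
    using assms by (intro prob_space_F_dist)
  have mix: "prob_space (mixture v (F_dist \<alpha> 0) (F_dist \<alpha> z))" if "v \<in> {0..1}" for v
    using that by (intro prob_space_mixture F) simp_all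
  have mix_B: "measure (mixture v (F_dist \<alpha> 0) (F_dist \<alpha> z)) B =
      v * measure (F_dist \<alpha> 0) B + (1 - v) * measure (F_dist \<alpha> z) B" if "v \<in> {0..1}" for v
    using that B F by (intro measure_mixture prob_space.finite_measure) simp_all
  have pair: "finite_measure (F_dist \<alpha> y \<Otimes>\<^sub>M mixture v (F_dist \<alpha> 0) (F_dist \<alpha> z)) \<and>
      measure (F_dist \<alpha> y \<Otimes>\<^sub>M mixture v (F_dist \<alpha> 0) (F_dist \<alpha> z)) (A \<times> B) =
      measure (F_dist \<alpha> y) A * measure (mixture v (F_dist \<alpha> 0) (F_dist \<alpha> z)) B"
    if "v \<in> {0..1}" for y v
  proof -
    interpret M: prob_space "F_dist \<alpha> y" by (rule F)
    interpret N: prob_space "mixture v (F_dist \<alpha> 0) (F_dist \<alpha> z)" using that by (rule mix)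
    interpret pair_prob_space "F_dist \<alpha> y" "mixture v (F_dist \<alpha> 0) (F_dist \<alpha> z)" ..
    show ?thesis
      using A B by (auto intro: finite_measure_axioms simp: measure_def
          N.emeasure_pair_measure_Times enn2real_mult)
  qed
  have "measure (P_mix \<alpha> w (q12, q21) z) (A \<times> B) =
      w * measure (F_dist \<alpha> 0 \<Otimes>\<^sub>M mixture (1 - q12) (F_dist \<alpha> 0) (F_dist \<alpha> z)) (A \<times> B) +
      (1 - w) * measure (F_dist \<alpha> z \<Otimes>\<^sub>M mixture q21 (F_dist \<alpha> 0) (F_dist \<alpha> z)) (A \<times> B)"
    unfolding P_mix_def prod.case
  proof (rule measure_mixture)
    show "sets (F_dist \<alpha> z \<Otimes>\<^sub>M mixture q21 (F_dist \<alpha> 0) (F_dist \<alpha> z)) =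
          sets (F_dist \<alpha> 0 \<Otimes>\<^sub>M mixture (1 - q12) (F_dist \<alpha> 0) (F_dist \<alpha> z))"
      by (rule sets_pair_measure_cong) simp_all
    show "A \<times> B \<in> sets (F_dist \<alpha> 0 \<Otimes>\<^sub>M mixture (1 - q12) (F_dist \<alpha> 0) (F_dist \<alpha> z))"
      using A B by (intro pair_measureI) simp_all
  qed (use assms pair in auto)
  then show ?thesis
    using assms pair mix_B by (simp add: mult.assoc)
qed

text \<open>
  Here \<open>a\<close> and \<open>b\<close> stand for the masses of an interval \<open>I\<close> under the two component distributions, and
  \<open>row\<close>, \<open>col\<close>, \<open>square\<close> compare the probabilities of \<open>I \<times> \<real>\<close>, \<open>\<real> \<times> I\<close> and \<open>I \<times> I\<close>. In the
  differences \<open>v\<close>, \<open>m\<close>, \<open>n\<close> of \<open>w\<close>, \<open>w q\<^sub>1\<^sub>2\<close>, \<open>(1-w) q\<^sub>2\<^sub>1\<close> the system is linear: the first gives \<open>v\<close>, the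
  second then \<open>m - n\<close>, the third \<open>a m - b n\<close>, and the last two determine \<open>m\<close> and \<open>n\<close> because \<open>a < b\<close>.
  Two divisions by \<open>b - a\<close> occur, hence the factor \<open>1/d\<^sup>4\<close> after squaring; the constant is
  \<open>6\<^sup>2 + 8\<^sup>2 + 1\<close>.
\<close>

lemma mixture_parameters_from_rectangles:
  fixes a b d e w q12 q21 w' q12' q21' :: real
  assumes ab: "0 \<le> a" "b \<le> 1" "0 < d" "d \<le> b - a"
    and q: "q12 \<in> {0..1}" "q21 \<in> {0..1}"
    and row: "\<bar>(w * a + (1 - w) * b) - (w' * a + (1 - w') * b)\<bar> \<le> e"
    and col: "\<bar>(w * ((1 - q12) * a + q12 * b) + (1 - w) * (q21 * a + (1 - q21) * b))
      - (w' * ((1 - q12') * a + q12' * b) + (1 - w') * (q21' * a + (1 - q21') * b))\<bar> \<le> e"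
    and square: "\<bar>(w * a * ((1 - q12) * a + q12 * b) + (1 - w) * b * (q21 * a + (1 - q21) * b))
      - (w' * a * ((1 - q12') * a + q12' * b) + (1 - w') * b * (q21' * a + (1 - q21') * b))\<bar> \<le> e"
  shows "w'\<^sup>2 * (q12 - q12')\<^sup>2 + (1 - w')\<^sup>2 * (q21 - q21')\<^sup>2 + (w - w')\<^sup>2 \<le> 101 * e\<^sup>2 / d^4"
proof -
  define m n where "m = w * q12 - w' * q12'" and "n = (1 - w) * q21 - (1 - w') * q21'"
  define v where "v = w - w'"
  have b: "0 \<le> b" "a \<le> 1" "d \<le> 1" using ab by linarith+
  have e: "0 \<le> e" using row by linarith
  have scale: "d * \<bar>x\<bar> \<le> y" if "\<bar>(b - a) * x\<bar> \<le> y" for x y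
  proof -
    have "d * \<bar>x\<bar> \<le> (b - a) * \<bar>x\<bar>" using ab by (intro mult_right_mono) auto
    then show ?thesis using that ab by (simp add: abs_mult)
  qed
  have shrink: "\<bar>c * x\<bar> \<le> \<bar>x\<bar>" if "0 \<le> c" "c \<le> 1" for c x :: real
    using that by (simp add: abs_mult mult_left_le_one_le)
  have v_e: "\<bar>(b - a) * v\<bar> \<le> e"
    using row by (simp add: v_def algebra_simps)
  have "(b - a) * (m - n) = ((w * ((1 - q12) * a + q12 * b) + (1 - w) * (q21 * a + (1 - q21) * b))
      - (w' * ((1 - q12') * a + q12' * b) + (1 - w') * (q21' * a + (1 - q21') * b))) + (b - a) * v"
    by (simp add: m_def n_def v_def algebra_simps)
  then have mn: "\<bar>(b - a) * (m - n)\<bar> \<le> 2 * e"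
    using col v_e by linarith
  have "(b - a) * (a * m - b * n) =
      ((w * a * ((1 - q12) * a + q12 * b) + (1 - w) * b * (q21 * a + (1 - q21) * b))
      - (w' * a * ((1 - q12') * a + q12' * b) + (1 - w') * b * (q21' * a + (1 - q21') * b)))
      + a * ((b - a) * v) + b * ((b - a) * v)"
    by (simp add: m_def n_def v_def algebra_simps power2_eq_square)
  then have amn: "\<bar>(b - a) * (a * m - b * n)\<bar> \<le> 3 * e"
    using square v_e shrink[of a "(b - a) * v"] shrink[of b "(b - a) * v"] ab b by linarith
  have "(b - a) * ((b - a) * m) = b * ((b - a) * (m - n)) - (b - a) * (a * m - b * n)"
    by (simp add: algebra_simps)
  then have "\<bar>(b - a) * ((b - a) * m)\<bar> \<le> 5 * e"
    using mn amn shrink[of b "(b - a) * (m - n)"] ab b by linarith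
  from scale[OF this] have "\<bar>(b - a) * (d * m)\<bar> \<le> 5 * e"
    using ab by (simp add: abs_mult mult.left_commute)
  then have m: "d\<^sup>2 * \<bar>m\<bar> \<le> 5 * e"
    using scale ab by (fastforce simp: abs_mult power2_eq_square mult.assoc)
  have small: "d\<^sup>2 * \<bar>x\<bar> \<le> y" if "d * \<bar>x\<bar> \<le> y" for x y
  proof -
    have "d * (d * \<bar>x\<bar>) \<le> d * \<bar>x\<bar>" using ab b by (intro mult_left_le_one_le) auto
    then show ?thesis using that by (simp add: power2_eq_square mult.assoc)
  qed
  have n: "d\<^sup>2 * \<bar>n\<bar> \<le> 7 * e"
  proof -
    have "d\<^sup>2 * \<bar>n\<bar> \<le> d\<^sup>2 * (\<bar>m\<bar> + \<bar>m - n\<bar>)" by (intro mult_left_mono) auto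
    then show ?thesis using m small[OF scale[OF mn]] by (simp add: distrib_left)
  qed
  have v: "d\<^sup>2 * \<bar>v\<bar> \<le> e" by (rule small[OF scale[OF v_e]])
  have p12: "d\<^sup>2 * \<bar>w' * (q12 - q12')\<bar> \<le> 6 * e"
  proof -
    have "\<bar>w' * (q12 - q12')\<bar> = \<bar>m - q12 * v\<bar>" by (simp add: m_def v_def algebra_simps)
    also have "\<dots> \<le> \<bar>m\<bar> + \<bar>v\<bar>" using shrink[of q12 v] q by auto
    finally have "d\<^sup>2 * \<bar>w' * (q12 - q12')\<bar> \<le> d\<^sup>2 * (\<bar>m\<bar> + \<bar>v\<bar>)" by (intro mult_left_mono) auto
    then show ?thesis using m v by (simp add: distrib_left)
  qed
  have p21: "d\<^sup>2 * \<bar>(1 - w') * (q21 - q21')\<bar> \<le> 8 * e"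
  proof -
    have "\<bar>(1 - w') * (q21 - q21')\<bar> = \<bar>n + q21 * v\<bar>" by (simp add: n_def v_def algebra_simps)
    also have "\<dots> \<le> \<bar>n\<bar> + \<bar>v\<bar>" using shrink[of q21 v] q by auto
    finally have "d\<^sup>2 * \<bar>(1 - w') * (q21 - q21')\<bar> \<le> d\<^sup>2 * (\<bar>n\<bar> + \<bar>v\<bar>)" by (intro mult_left_mono) auto
    then show ?thesis using n v by (simp add: distrib_left)
  qed
  have square_le: "d^4 * x\<^sup>2 \<le> k\<^sup>2 * e\<^sup>2" if "d\<^sup>2 * \<bar>x\<bar> \<le> k * e" for x k
  proof -
    have "(d\<^sup>2 * \<bar>x\<bar>)\<^sup>2 \<le> (k * e)\<^sup>2" using that by (intro power_mono) auto
    then show ?thesis by (simp add: power_mult_distrib)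
  qed
  have "d^4 * (w'\<^sup>2 * (q12 - q12')\<^sup>2 + (1 - w')\<^sup>2 * (q21 - q21')\<^sup>2 + (w - w')\<^sup>2) \<le> 101 * e\<^sup>2"
    using square_le[OF p12] square_le[OF p21] square_le[of v 1] v
    by (simp add: power_mult_distrib distrib_left v_def)
  then show ?thesis using ab by (simp add: field_simps)
qed

section \<open>Identification of the parameters\<close>

text \<open>
  The test event is \<open>I \<times> \<real>\<close> for an interval \<open>I\<close> around \<open>z\<^sup>*\<close> of radius proportional to
  \<open>\<bar>z - z\<^sup>*\<bar> \<and> 1\<close>; the constant \<open>K\<close> is so large that at distance \<open>K r\<close> from the singularity the mass of
  \<open>I\<close> is only \<open>(1 - w\<^sup>*)/4\<close> of its mass at the singularity. Comparing square roots rather than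
  probabilities is what gives the exponent \<open>1 - \<alpha>\<close> for \<open>h\<^sup>2\<close> instead of \<open>2 (1 - \<alpha>)\<close>.
\<close>

lemma hellinger_detects_location:
  fixes \<alpha> zs ws q12s q21s :: real
  assumes "0 < \<alpha>" "\<alpha> < 1" "zs \<noteq> 0" "0 \<le> ws" "ws < 1"
    and "q12s \<in> {0..1}" "q21s \<in> {0..1}"
  shows "\<exists>C>0. \<forall>w\<in>{0..1}. \<forall>q12\<in>{0..1}. \<forall>q21\<in>{0..1}. \<forall>z.
    (min \<bar>z - zs\<bar> 1) powr (1 - \<alpha>)
      \<le> C * (hellinger (P_mix \<alpha> w (q12, q21) z) (P_mix \<alpha> ws (q12s, q21s) zs))\<^sup>2"
proof -
  define K where "K = ((1 - ws) / 4) powr (- 1 / \<alpha>)"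
  have K: "K > 0" "K powr (- \<alpha>) = (1 - ws) / 4"
    using assms by (simp_all add: K_def powr_powr)
  define s where "s = min 1 \<bar>zs\<bar> / (1 + K)"
  have "(1 + K) * s = min 1 \<bar>zs\<bar>" "s \<le> (1 + K) * s"
    using K(1) assms(3) by (simp_all add: s_def field_simps)
  then have s: "s > 0" "s \<le> 1" "(1 + K) * s \<le> \<bar>zs\<bar>" "(1 + K) * s \<le> 1"
    using assms(3) K(1) by (auto simp: s_def)
  define k where "k = (1 - ws) * (1 - \<alpha>) * s powr (1 - \<alpha>)"
  have k: "k > 0" using assms s by (simp add: k_def)
  have "(min \<bar>z - zs\<bar> 1) powr (1 - \<alpha>)
      \<le> 8 / k * (hellinger (P_mix \<alpha> w (q12, q21) z) (P_mix \<alpha> ws (q12s, q21s) zs))\<^sup>2"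
    if q: "w \<in> {0..1}" "q12 \<in> {0..1}" "q21 \<in> {0..1}" for w q12 q21 z
  proof (cases "z = zs")
    case False
    let ?P = "P_mix \<alpha> w (q12, q21) z" and ?Q = "P_mix \<alpha> ws (q12s, q21s) zs"
    define t where "t = min \<bar>z - zs\<bar> 1"
    have t: "t > 0" "t \<le> 1" "t \<le> \<bar>z - zs\<bar>" using False by (auto simp: t_def)
    define r where "r = t * s"
    have r_s: "r \<le> s" and r_t: "(1 + K) * r \<le> t"
      using s t K mult_left_mono[OF s(4), of t] by (simp_all add: r_def mult_left_le_one_le ac_simps)
    have "r > 0" using s t by (simp add: r_def)
    with r_s s(2) have r: "r > 0" "r \<le> 1" by auto
    have "(1 + K) * r \<le> (1 + K) * s"
      using r_s K by (intro mult_left_mono) auto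
    then have far: "(1 + K) * r \<le> \<bar>zs - y\<bar>" if "y = 0 \<or> y = z" for y
      using that r_t t(3) s(3) by auto
    define u where "u = (1 - ws) * ((1 - \<alpha>) * r powr (- \<alpha>) * r)"
    have u: "u = k * t powr (1 - \<alpha>)"
    proof -
      have "r powr (- \<alpha>) * r = r powr (1 - \<alpha>)"
        using r powr_add[of r "- \<alpha>" 1] by simp
      then have "u = (1 - ws) * (1 - \<alpha>) * r powr (1 - \<alpha>)"
        by (simp add: u_def mult.assoc)
      then show ?thesis
        using s t by (simp add: k_def r_def powr_mult)
    qed
    have "u > 0" using u k t by simp
    let ?I = "cball zs r"
    interpret F: prob_space "F_dist \<alpha> y" for y using assms by (intro prob_space_F_dist)
    have F_UNIV: "measure (F_dist \<alpha> y) UNIV = 1" for y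
      using F.prob_space[of y] by (simp add: F_dist_def)
    have strip: "measure (P_mix \<alpha> v (p12, p21) y) (?I \<times> UNIV) =
        v * measure (F_dist \<alpha> 0) ?I + (1 - v) * measure (F_dist \<alpha> y) ?I"
      if "v \<in> {0..1}" "p12 \<in> {0..1}" "p21 \<in> {0..1}" for v p12 p21 y
      using that assms by (subst measure_P_mix_Times) (simp_all add: F_UNIV)
    have upper: "measure (F_dist \<alpha> y) ?I \<le> u / 4" if "y = 0 \<or> y = z" for y
    proof -
      have "measure (F_dist \<alpha> y) ?I \<le> (1 - \<alpha>) * (K * r) powr (- \<alpha>) * r"
        using far[OF that] r K assms by (intro F_dist_cball_upper) (auto simp: algebra_simps)
      also have "\<dots> = u / 4"
        using K r by (simp add: powr_mult u_def)
      finally show ?thesis .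
    qed
    have "measure ?P (?I \<times> UNIV) \<le> w * (u / 4) + (1 - w) * (u / 4)"
      using q upper by (simp only: strip) (intro add_mono mult_left_mono; simp)
    then have P: "measure ?P (?I \<times> UNIV) \<le> u / 4" by (simp add: field_simps)
    have "(1 - ws) * ((1 - \<alpha>) * r powr (- \<alpha>) * r) \<le> (1 - ws) * measure (F_dist \<alpha> zs) ?I"
      using assms r by (intro mult_left_mono F_dist_cball_lower) auto
    also have "\<dots> \<le> measure ?Q (?I \<times> UNIV)"
      using assms by (simp add: strip)
    finally have Q: "u \<le> measure ?Q (?I \<times> UNIV)" by (simp add: u_def)
    have "sqrt (measure ?P (?I \<times> UNIV)) \<le> sqrt u / 2"
      using real_sqrt_le_mono[OF P] by (simp add: real_sqrt_divide)
    moreover have "sqrt u \<le> sqrt (measure ?Q (?I \<times> UNIV))"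
      using Q by simp
    ultimately have "sqrt u / 2 \<le> \<bar>sqrt (measure ?P (?I \<times> UNIV)) - sqrt (measure ?Q (?I \<times> UNIV))\<bar>"
      by linarith
    then have "(sqrt u / 2)\<^sup>2 \<le> (sqrt (measure ?P (?I \<times> UNIV)) - sqrt (measure ?Q (?I \<times> UNIV)))\<^sup>2"
      using \<open>u > 0\<close> by (subst abs_le_square_iff[symmetric]) simp
    also have "\<dots> \<le> 2 * (hellinger ?P ?Q)\<^sup>2"
    proof (rule sqrt_measure_diff_le_hellinger)
      show "?I \<times> UNIV \<in> sets ?P"
        using borel_Times[of ?I UNIV] by simp
    qed (use assms q in \<open>auto intro!: prob_space.finite_measure prob_space_P_mix\<close>)
    finally have "u \<le> 8 * (hellinger ?P ?Q)\<^sup>2"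
      using \<open>u > 0\<close> by (simp add: power_divide)
    then show ?thesis
      using k by (simp add: u t_def field_simps)
  qed (use k in simp)
  then show ?thesis
    using k by (intro exI[of _ "8 / k"]) auto
qed

text \<open>
  The interval \<open>I\<close> is centred at the midpoint of \<open>z\<close> and \<open>z\<^sup>*\<close>, so that replacing \<open>z\<close> by \<open>z\<^sup>*\<close> does not
  change its mass. Its radius is fixed: small enough that \<open>0\<close> is far from \<open>I\<close>, and large enough,
  compared with \<open>\<bar>z - z\<^sup>*\<bar>\<close>, that \<open>z\<^sup>*\<close> lies in \<open>I\<close>.
\<close>

lemma hellinger_detects_weights:
  fixes \<alpha> zs ws q12s q21s :: real
  assumes "0 < \<alpha>" "\<alpha> < 1" "zs \<noteq> 0" "ws \<in> {0..1}" "q12s \<in> {0..1}" "q21s \<in> {0..1}"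
  shows "\<exists>\<eta>>0. \<exists>C>0. \<eta> \<le> 1 \<and> (\<forall>w\<in>{0..1}. \<forall>q12\<in>{0..1}. \<forall>q21\<in>{0..1}. \<forall>z. \<bar>z - zs\<bar> \<le> \<eta> \<longrightarrow>
    ws\<^sup>2 * (q12 - q12s)\<^sup>2 + (1 - ws)\<^sup>2 * (q21 - q21s)\<^sup>2 + (w - ws)\<^sup>2
      \<le> C * (hellinger (P_mix \<alpha> w (q12, q21) z) (P_mix \<alpha> ws (q12s, q21s) zs))\<^sup>2)"
proof -
  \<comment> \<open>The factor \<open>K\<close> between far and near distance halves the mass, so \<open>d\<close> below is at most \<open>b - a\<close>.\<close>
  define K where "K = 2 powr (1 / \<alpha>)"
  have K: "K > 0" "K powr (- \<alpha>) = 1 / 2"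
    using assms by (simp_all add: K_def powr_powr powr_minus_divide)
  define r where "r = min 1 \<bar>zs\<bar> / (2 + 2 * K)"
  have "(2 + 2 * K) * r = min 1 \<bar>zs\<bar>" "2 * r \<le> (2 + 2 * K) * r"
    using K(1) assms(3) by (simp_all add: r_def field_simps)
  then have r: "r > 0" "2 * r \<le> 1" "(2 + 2 * K) * r \<le> \<bar>zs\<bar>"
    using assms(3) K(1) by (auto simp: r_def)
  define d where "d = (1 - \<alpha>) * (2 * r) powr (- \<alpha>) * r / 2"
  have d: "d > 0" using assms r by (simp add: d_def)
  have "ws\<^sup>2 * (q12 - q12s)\<^sup>2 + (1 - ws)\<^sup>2 * (q21 - q21s)\<^sup>2 + (w - ws)\<^sup>2
      \<le> 808 / d^4 * (hellinger (P_mix \<alpha> w (q12, q21) z) (P_mix \<alpha> ws (q12s, q21s) zs))\<^sup>2"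
    if q: "w \<in> {0..1}" "q12 \<in> {0..1}" "q21 \<in> {0..1}" and near: "\<bar>z - zs\<bar> \<le> 2 * r" for w q12 q21 z
  proof -
    let ?P = "P_mix \<alpha> w (q12, q21) z" and ?Q = "P_mix \<alpha> ws (q12s, q21s) zs"
    define I where "I = cball ((z + zs) / 2) r"
    define a b where "a = measure (F_dist \<alpha> 0) I" and "b = measure (F_dist \<alpha> zs) I"
    interpret F: prob_space "F_dist \<alpha> y" for y using assms by (intro prob_space_F_dist)
    have F_UNIV: "measure (F_dist \<alpha> y) UNIV = 1" for y
      using F.prob_space[of y] by (simp add: F_dist_def)
    have I: "I \<in> sets borel" by (simp add: I_def)
    have b_z: "measure (F_dist \<alpha> z) I = b"
      unfolding b_def I_def by (rule F_dist_cball_midpoint)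
    have "(1 - \<alpha>) * (2 * r) powr (- \<alpha>) * r \<le> b"
      unfolding b_def I_def
      using near r assms by (intro F_dist_cball_lower) (auto simp: abs_if field_simps split: if_splits)
    moreover have "a \<le> (1 - \<alpha>) * (K * (2 * r)) powr (- \<alpha>) * r"
      unfolding a_def I_def
      using near r assms K
      by (intro F_dist_cball_upper) (auto simp: abs_if field_simps split: if_splits)
    then have "a \<le> (1 - \<alpha>) * (2 * r) powr (- \<alpha>) * r / 2"
      using K r by (simp add: powr_mult)
    ultimately have gap: "d \<le> b - a" by (simp add: d_def)
    define e where "e = sqrt 8 * \<bar>hellinger ?P ?Q\<bar>"
    have diff: "\<bar>measure ?P (A \<times> B) - measure ?Q (A \<times> B)\<bar> \<le> e"
      if "A \<in> sets borel" "B \<in> sets borel" for A B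
      unfolding e_def
    proof (rule measure_diff_le_hellinger)
      show "A \<times> B \<in> sets ?P"
        using borel_Times[OF that] by simp
    qed (use assms q prob_space_P_mix in auto)
    have "ws\<^sup>2 * (q12 - q12s)\<^sup>2 + (1 - ws)\<^sup>2 * (q21 - q21s)\<^sup>2 + (w - ws)\<^sup>2 \<le> 101 * e\<^sup>2 / d^4"
    proof (rule mixture_parameters_from_rectangles)
      show "\<bar>(w * a + (1 - w) * b) - (ws * a + (1 - ws) * b)\<bar> \<le> e"
        using diff[OF I, of UNIV] assms q I
        by (simp add: measure_P_mix_Times F_UNIV b_z flip: a_def b_def)
      show "\<bar>(w * ((1 - q12) * a + q12 * b) + (1 - w) * (q21 * a + (1 - q21) * b))
          - (ws * ((1 - q12s) * a + q12s * b) + (1 - ws) * (q21s * a + (1 - q21s) * b))\<bar> \<le> e"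
        using diff[OF _ I, of UNIV] assms q I
        by (simp add: measure_P_mix_Times F_UNIV b_z flip: a_def b_def)
      show "\<bar>(w * a * ((1 - q12) * a + q12 * b) + (1 - w) * b * (q21 * a + (1 - q21) * b))
          - (ws * a * ((1 - q12s) * a + q12s * b) + (1 - ws) * b * (q21s * a + (1 - q21s) * b))\<bar> \<le> e"
        using diff[OF I I] assms q I
        by (simp add: measure_P_mix_Times b_z flip: a_def b_def)
    qed (use gap d q in \<open>auto simp: a_def b_def\<close>)
    then show ?thesis by (simp add: e_def power_mult_distrib)
  qed
  then show ?thesis
    using r d by (intro exI[of _ "2 * r"] conjI exI[of _ "808 / d^4"]) auto
qed

theorem proposition3:
  fixes \<alpha> zs ws q12s q21s :: real
  assumes "0 < \<alpha>" "\<alpha> < 1"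
    and "zs \<noteq> 0"
    and "0 \<le> ws" "ws < 1"
    and "0 \<le> q12s" "q12s \<le> 1"
    and "0 \<le> q21s" "q21s < 1"
  shows "\<exists>C::real. C > 0 \<and>
    (\<forall>w\<in>{0..1}. \<forall>q12\<in>{0..1}. \<forall>q21\<in>{0..1}. \<forall>z.
       C * (hellinger (P_mix \<alpha> w (q12, q21) z) (P_mix \<alpha> ws (q12s, q21s) zs))\<^sup>2
         \<ge> (min \<bar>z - zs\<bar> 1) powr (1 - \<alpha>)
           + ws\<^sup>2 * (q12 - q12s)\<^sup>2
           + (1 - ws)\<^sup>2 * (q21 - q21s)\<^sup>2
           + (w - ws)\<^sup>2)"
proof -
  obtain C1 where C1: "C1 > 0" and location: "\<And>w q12 q21 z.
      w \<in> {0..1} \<Longrightarrow> q12 \<in> {0..1} \<Longrightarrow> q21 \<in> {0..1} \<Longrightarrow>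
      (min \<bar>z - zs\<bar> 1) powr (1 - \<alpha>)
        \<le> C1 * (hellinger (P_mix \<alpha> w (q12, q21) z) (P_mix \<alpha> ws (q12s, q21s) zs))\<^sup>2"
    using hellinger_detects_location[of \<alpha> zs ws q12s q21s] assms by auto
  obtain \<eta> C2 where \<eta>: "\<eta> > 0" "\<eta> \<le> 1" and C2: "C2 > 0" and weights: "\<And>w q12 q21 z.
      w \<in> {0..1} \<Longrightarrow> q12 \<in> {0..1} \<Longrightarrow> q21 \<in> {0..1} \<Longrightarrow> \<bar>z - zs\<bar> \<le> \<eta> \<Longrightarrow>
      ws\<^sup>2 * (q12 - q12s)\<^sup>2 + (1 - ws)\<^sup>2 * (q21 - q21s)\<^sup>2 + (w - ws)\<^sup>2
        \<le> C2 * (hellinger (P_mix \<alpha> w (q12, q21) z) (P_mix \<alpha> ws (q12s, q21s) zs))\<^sup>2"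
    using hellinger_detects_weights[of \<alpha> zs ws q12s q21s] assms by auto
  \<comment> \<open>If \<open>z\<close> is farther than \<open>\<eta>\<close> from \<open>z\<^sup>*\<close>, the location bound gives \<open>\<eta>\<^bsup>1-\<alpha>\<^esup> \<le> C1 h\<^sup>2\<close>,
    and the three weight terms are at most 1 each.\<close>
  define C3 where "C3 = 3 * C1 / \<eta> powr (1 - \<alpha>)"
  have C3: "C3 > 0" using C1 \<eta> by (simp add: C3_def)
  have "(min \<bar>z - zs\<bar> 1) powr (1 - \<alpha>)
      + (ws\<^sup>2 * (q12 - q12s)\<^sup>2 + (1 - ws)\<^sup>2 * (q21 - q21s)\<^sup>2 + (w - ws)\<^sup>2)
      \<le> (C1 + C2 + C3) * (hellinger (P_mix \<alpha> w (q12, q21) z) (P_mix \<alpha> ws (q12s, q21s) zs))\<^sup>2"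
    if q: "w \<in> {0..1}" "q12 \<in> {0..1}" "q21 \<in> {0..1}" for w q12 q21 z
  proof -
    define h2 where "h2 = (hellinger (P_mix \<alpha> w (q12, q21) z) (P_mix \<alpha> ws (q12s, q21s) zs))\<^sup>2"
    define W where "W = ws\<^sup>2 * (q12 - q12s)\<^sup>2 + (1 - ws)\<^sup>2 * (q21 - q21s)\<^sup>2 + (w - ws)\<^sup>2"
    have loc: "(min \<bar>z - zs\<bar> 1) powr (1 - \<alpha>) \<le> C1 * h2"
      using location q by (simp add: h2_def)
    have h2: "0 \<le> h2" by (simp add: h2_def)
    have "W \<le> C2 * h2 + C3 * h2"
    proof (cases "\<bar>z - zs\<bar> \<le> \<eta>")
      case True
      then have "W \<le> C2 * h2" using weights q by (simp add: W_def h2_def)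
      moreover have "0 \<le> C3 * h2" using C3 h2 by simp
      ultimately show ?thesis by linarith
    next
      case False
      have unit: "x\<^sup>2 \<le> 1" if "\<bar>x\<bar> \<le> 1" for x :: real
        using that by (simp add: abs_square_le_1)
      have "ws\<^sup>2 * (q12 - q12s)\<^sup>2 \<le> 1 * 1" "(1 - ws)\<^sup>2 * (q21 - q21s)\<^sup>2 \<le> 1 * 1" "(w - ws)\<^sup>2 \<le> 1"
        using assms q by (intro mult_mono unit; auto)+
      then have "W \<le> 3" by (simp add: W_def)
      moreover have "\<eta> powr (1 - \<alpha>) \<le> C1 * h2"
        using False \<eta> assms by (intro order_trans[OF powr_mono2 loc]) auto
      then have "3 \<le> C3 * h2" using \<eta> by (simp add: C3_def field_simps)
      moreover have "0 \<le> C2 * h2" using C2 h2 by simp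
      ultimately show ?thesis by linarith
    qed
    with loc show ?thesis by (simp add: W_def h2_def algebra_simps)
  qed
  then show ?thesis
    using C1 C2 C3 by (intro exI[of _ "C1 + C2 + C3"]) (auto simp: add.assoc)
qed

end
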